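(* Let $p$ be a non-zero isotropic element of $\mathbb{C}^n$, i.e. such that $(p,p)=0$. Then the set $$\mathcal{E}(p)=\{\phi_a:\mathbf{SO}(n)\to\mathbb{C}\mid \phi_a(x)=\operatorname{trace}(p^t a x^t),\ a\in\mathbb{C}^n\}$$ of complex valued functions is an eigenfamily on $\mathbf{SO}(n)$.
   Context: $\mathbf{SO}(n)=\{x\in\mathbf{GL}_n(\mathbb{R})\mid x x^t=I_n,\ \det x=1\}$ carries the left-invariant Riemannian metric induced by the scalar product $g(Z,W)=\operatorname{Re}\operatorname{trace}(ZW^* )$ on its Lie algebra $\mathfrak{so}(n)$ of real skew-symmetric $n\times n$ matrices. Elements of $\mathbb{C}^n$ are row vectors, so $p^t a$ is an $n\times n$ complex matrix, and $(a,b)=\sum_{k=1}^n a_k b_k$ is the standard complex bilinear form on $\mathbb{C}^n$. For complex valued functions $\phi,\psi$ on a semi-Riemannian manifold $(M,g)$, $\tau(\phi)$ is the Laplacian ($\operatorname{div}\operatorname{grad}$) extended complex linearly and $\kappa(\phi,\psi)=g(\operatorname{grad}(\phi),\operatorname{grad}(\psi))$ with $g$ extended complex bilinearly. On $\mathbf{SO}(n)$ these are $\tau(\phi)=\sum_{Z\in\mathcal{B}}Z^2(\phi)$ and $\kappa(\phi,\psi)=\sum_{Z\in\mathcal{B}}Z(\phi)Z(\psi)$ for any orthonormal basis $\mathcal{B}$ of the Lie algebra of left-invariant vector fields. A set $\mathcal{E}$ of complex valued functions on $M$ is an eigenfamily if there exist $\lambda,\mu\in\mathbb{C}$ such that $\tau(\phi)=\lambda\phi$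 and $\kappa(\phi,\psi)=\mu\,\phi\psi$ for all $\phi,\psi\in\mathcal{E}$. *)

theory Defs
  imports "HOL-Analysis.Analysis"
begin

section \<open>The group, its Lie algebra and its metric\<close>

definition SO :: "(real^'n^'n) set" where
  "SO = {x. invertible x \<and> x ** transpose x = mat 1 \<and> det x = 1}"

definition so :: "(real^'n^'n) set" where
  "so = {Z. transpose Z = - Z}"

text \<open>The scalar product \<open>Re trace (Z W*)\<close>, for real matrices.\<close>

definition so_metric :: "real^'n^'n \<Rightarrow> real^'n^'n \<Rightarrow> real" where
  "so_metric Z W = trace (Z ** transpose W)"

definition so_orthonormal_basis :: "(real^'n^'n) set \<Rightarrow> bool" where
  "so_orthonormal_basis B \<longleftrightarrow>
     B \<subseteq> so \<and> span B = so \<and>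
     (\<forall>Z\<in>B. \<forall>W\<in>B. so_metric Z W = (if Z = W then 1 else 0))"

text \<open>The library has no multiplicative structure on \<open>real^'n^'n\<close> for which the
  generic \<open>exp\<close> would be the matrix exponential (\<open>*\<close> is not matrix multiplication there).\<close>

definition mat_exp :: "real^'n^'n \<Rightarrow> real^'n^'n" where
  "mat_exp A = (\<Sum>k. (1 / fact k) *\<^sub>R ((\<lambda>M. A ** M) ^^ k) (mat 1))"


section \<open>Differential operators on complex valued functions\<close>

text \<open>
  Functions on \<open>SO\<close> are represented by total functions on matrices. For \<open>x \<in> SO\<close> and
  \<open>Z \<in> so\<close> the curve \<open>t \<mapsto> x exp (t Z)\<close> stays in \<open>SO\<close>, so every notion below,
  evaluated at points of \<open>SO\<close>, depends only on the restriction of the function to \<open>SO\<close>.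

  \<open>lie_deriv Z f\<close> is \<open>Z f\<close>, where \<open>Z \<in> so\<close> is identified with the left-invariant vector
  field \<open>x \<mapsto> x Z\<close>, whose integral curve through \<open>x\<close> is \<open>t \<mapsto> x exp (t Z)\<close>.
\<close>

definition lie_deriv ::
  "real^'n^'n \<Rightarrow> (real^'n^'n \<Rightarrow> complex) \<Rightarrow> real^'n^'n \<Rightarrow> complex" where
  "lie_deriv Z f x = vector_derivative (\<lambda>t. f (x ** mat_exp (t *\<^sub>R Z))) (at 0)"

text \<open>
  Smoothness on \<open>SO\<close>: all iterated derivatives along left-invariant vector fields exist and
  are continuous. As these fields span every tangent space, this is the usual notion.
\<close>

definition smooth_on_SO :: "(real^'n^'n \<Rightarrow> complex) \<Rightarrow> bool" where
  "smooth_on_SO f \<longleftrightarrow>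
     (\<forall>Zs. set Zs \<subseteq> so \<longrightarrow>
        continuous_on SO (foldr lie_deriv Zs f) \<and>
        (\<forall>Z\<in>so. \<forall>x\<in>SO.
           (\<lambda>t. foldr lie_deriv Zs f (x ** mat_exp (t *\<^sub>R Z))) differentiable (at 0)))"

text \<open>
  The Laplacian and the bilinear operator \<open>g (grad f, grad h)\<close> in an orthonormal frame \<open>B\<close>
  of left-invariant vector fields.
\<close>

definition tau ::
  "(real^'n^'n) set \<Rightarrow> (real^'n^'n \<Rightarrow> complex) \<Rightarrow> real^'n^'n \<Rightarrow> complex" where
  "tau B f x = (\<Sum>Z\<in>B. lie_deriv Z (lie_deriv Z f) x)"

definition kappa ::
  "(real^'n^'n) set \<Rightarrow> (real^'n^'n \<Rightarrow> complex) \<Rightarrow> (real^'n^'n \<Rightarrow> complex)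
     \<Rightarrow> real^'n^'n \<Rightarrow> complex" where
  "kappa B f h x = (\<Sum>Z\<in>B. lie_deriv Z f x * lie_deriv Z h x)"

text \<open>
  Neither operator depends on the orthonormal basis; the equations are required for all of
  them, with the same eigenvalues. Lemma \<open>so_orthonormal_basis_exists\<close> below shows that
  this quantification is not vacuous.
\<close>

definition eigenfamily_on_SO :: "(real^'n^'n \<Rightarrow> complex) set \<Rightarrow> bool" where
  "eigenfamily_on_SO E \<longleftrightarrow>
     (\<forall>f\<in>E. smooth_on_SO f) \<and>
     (\<exists>l m :: complex. \<forall>B. so_orthonormal_basis B \<longrightarrow>
        (\<forall>f\<in>E. \<forall>h\<in>E. \<forall>x\<in>SO.
           tau B f x = l * f x \<and> kappa B f h x = m * f x * h x))"

lemma so_metric_eq_inner: "so_metric Z W = Z \<bullet> W"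
  by (simp add: so_metric_def trace_def matrix_matrix_mult_def transpose_def inner_vec_def)

lemma subspace_so: "subspace (so :: (real^'n^'n) set)"
proof -
  have t: "transpose (0 :: real^'n^'n) = 0"
      "transpose (X + Y) = transpose X + transpose Y"
      "transpose (c *\<^sub>R X) = c *\<^sub>R transpose X" for X Y :: "real^'n^'n" and c
    by (simp_all add: transpose_def vec_eq_iff)
  show ?thesis
    by (simp add: subspace_def so_def t)
qed

lemma so_orthonormal_basis_exists: "\<exists>B :: (real^'n^'n) set. so_orthonormal_basis B"
proof -
  obtain B :: "(real^'n^'n) set" where B: "B \<subseteq> so" "pairwise orthogonal B"
    "\<And>x. x \<in> B \<Longrightarrow> norm x = 1" "span B = so"
    by (rule orthonormal_basis_subspace[OF subspace_so]) blast
  have "so_metric Z W = (if Z = W then 1 else 0)" if "Z \<in> B" "W \<in> B" for Z W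
  proof (cases "Z = W")
    case True
    then show ?thesis using B(3)[OF that(1)] by (simp add: so_metric_eq_inner norm_eq_1)
  next
    case False
    then have "orthogonal Z W" using B(2) that by (simp add: pairwise_def)
    then show ?thesis using False by (simp add: so_metric_eq_inner orthogonal_def)
  qed
  with B(1,4) have "so_orthonormal_basis B"
    unfolding so_orthonormal_basis_def by blast
  then show ?thesis by blast
qed


section \<open>The functions\<close>

definition bilin :: "complex^'n \<Rightarrow> complex^'n \<Rightarrow> complex" where
  "bilin a b = (\<Sum>k\<in>UNIV. a $ k * b $ k)"

text \<open>Elements of \<open>complex^'n\<close> are row vectors, i.e. \<open>1 \<times> n\<close> matrices via \<open>rowvector\<close>.\<close>

definition phi :: "complex^'n \<Rightarrow> complex^'n \<Rightarrow> real^'n^'n \<Rightarrow> complex" where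
  "phi p a x =
     trace ((transpose (rowvector p :: complex^'n^1) ** (rowvector a :: complex^'n^1))
            ** map_matrix complex_of_real (transpose x))"

definition family_E :: "complex^'n \<Rightarrow> (real^'n^'n \<Rightarrow> complex) set" where
  "family_E p = {phi p a | a. True}"

end

theory Submission
  imports Defs
begin

text \<open>
  Each \<open>\<phi>\<^sub>a\<close> is the restriction of a linear functional, and along a left-invariant field
  \<open>Z\<close> a linear functional \<open>f\<close> has derivative \<open>x \<mapsto> f (x Z)\<close>, again linear. Everything then
  reduces to the completeness relation
  \<open>\<Sum>\<^sub>Z Z\<^sub>k\<^sub>l Z\<^sub>r\<^sub>s = (\<delta>\<^sub>k\<^sub>r \<delta>\<^sub>l\<^sub>s - \<delta>\<^sub>k\<^sub>s \<delta>\<^sub>l\<^sub>r) / 2\<close> for an orthonormal basis of \<open>so\<close>. It gives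
  \<open>\<Sum>\<^sub>Z Z\<^sup>2 = - (n - 1) / 2\<close>, hence \<open>\<lambda> = - (n - 1) / 2\<close>; and with \<open>q = p x\<close> it gives
  \<open>\<kappa> = ((q, q) (a, b) - (q, a) (q, b)) / 2\<close>, where \<open>(q, q) = (p, p) = 0\<close> because \<open>x\<close> is
  orthogonal and \<open>(q, a) = \<phi>\<^sub>a x\<close>, hence \<open>\<mu> = - 1 / 2\<close>.
\<close>

lemma linear_matrix_mult_left: "linear (\<lambda>M :: real^'n^'n. A ** M)"
  by (rule linearI)
    (simp_all add: vec_eq_iff matrix_matrix_mult_def algebra_simps sum.distrib sum_distrib_left)

lemma linear_matrix_mult_right: "linear (\<lambda>M :: real^'n^'n. M ** A)"
  by (rule linearI)
    (simp_all add: vec_eq_iff matrix_matrix_mult_def algebra_simps sum.distrib sum_distrib_left)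

text \<open>Isolates the powers of \<open>t\<close>, so that the exponential series along
  \<open>t *\<^sub>R Z\<close> becomes a power series in \<open>t\<close>.\<close>

lemma matrix_power_scaleR:
  fixes Z :: "real^'n^'n"
  shows "((\<lambda>M. (t *\<^sub>R Z) ** M) ^^ k) (mat 1) = t ^ k *\<^sub>R ((\<lambda>M. Z ** M) ^^ k) (mat 1)"
proof (induction k)
  case (Suc k)
  have "(t *\<^sub>R Z) ** (c *\<^sub>R N) = (t * c) *\<^sub>R (Z ** N)" for c and N :: "real^'n^'n"
    by (simp add: vec_eq_iff matrix_matrix_mult_def sum_distrib_left mult_ac)
  with Suc show ?case by simp
qed simp

text \<open>Left multiplication by \<open>Z\<close> is bounded by some \<open>K\<close>, so the
  terms are dominated by those of the scalar exponential series at \<open>K\<close>, up to the norm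
  of the identity.\<close>

lemma summable_mat_exp:
  fixes Z :: "real^'n^'n"
  shows "summable (\<lambda>k. (1 / fact k) *\<^sub>R ((\<lambda>M. Z ** M) ^^ k) (mat 1))"
proof -
  have "bounded_linear (\<lambda>M :: real^'n^'n. Z ** M)"
    using linear_matrix_mult_left by (simp add: linear_conv_bounded_linear)
  then obtain K where K: "K > 0" "\<And>M :: real^'n^'n. norm (Z ** M) \<le> norm M * K"
    using bounded_linear.pos_bounded by blast
  have bound: "norm (((\<lambda>M. Z ** M) ^^ k) (mat 1)) \<le> K ^ k * norm (mat 1 :: real^'n^'n)" for k
  proof (induction k)
    case (Suc k)
    have "norm (((\<lambda>M. Z ** M) ^^ Suc k) (mat 1)) \<le> norm (((\<lambda>M. Z ** M) ^^ k) (mat 1)) * K"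
      using K(2) by simp
    also have "\<dots> \<le> (K ^ k * norm (mat 1 :: real^'n^'n)) * K"
      using Suc K(1) by (intro mult_right_mono) auto
    finally show ?case by (simp add: mult_ac)
  qed simp
  show ?thesis
  proof (rule summable_comparison_test')
    show "summable (\<lambda>k. inverse (fact k) * K ^ k * norm (mat 1 :: real^'n^'n))"
      by (intro summable_mult2 summable_exp)
    show "norm ((1 / fact k) *\<^sub>R ((\<lambda>M. Z ** M) ^^ k) (mat 1))
        \<le> inverse (fact k) * K ^ k * norm (mat 1 :: real^'n^'n)" for k
      using bound[of k] by (simp add: field_simps)
  qed
qed

text \<open>A linear \<open>g\<close> passes through the exponential series and leaves a scalar
  power series in \<open>t\<close>, which can be differentiated term by term.\<close>

lemma has_vector_derivative_linear_mat_exp: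
  fixes g :: "real^'n^'n \<Rightarrow> complex"
  assumes "linear g"
  shows "((\<lambda>t. g (mat_exp (t *\<^sub>R Z))) has_vector_derivative g Z) (at 0)"
proof -
  have bl: "bounded_linear g"
    using assms by (simp add: linear_conv_bounded_linear)
  define c where "c k = g ((1 / fact k) *\<^sub>R ((\<lambda>M. Z ** M) ^^ k) (mat 1))" for k
  have coeff: "g ((1 / fact k) *\<^sub>R ((\<lambda>M. (t *\<^sub>R Z) ** M) ^^ k) (mat 1)) = c k * of_real t ^ k"
    for t k
  proof -
    have "(1 / fact k) *\<^sub>R ((\<lambda>M. (t *\<^sub>R Z) ** M) ^^ k) (mat 1)
        = t ^ k *\<^sub>R ((1 / fact k) *\<^sub>R ((\<lambda>M. Z ** M) ^^ k) (mat 1))"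
      by (simp add: matrix_power_scaleR)
    then show ?thesis
      by (simp only: c_def linear_cmul[OF assms]) (simp add: scaleR_conv_of_real)
  qed
  have series: "(\<lambda>k. c k * of_real t ^ k) sums g (mat_exp (t *\<^sub>R Z))" for t
    using bounded_linear.sums[OF bl summable_sums[OF summable_mat_exp[of "t *\<^sub>R Z"]]]
    by (simp add: coeff mat_exp_def)
  \<comment> \<open>Term-by-term differentiation is done in a complex variable. The series converges
    at the real point \<open>norm z + 1\<close>, whose modulus exceeds that of \<open>z\<close>,
    hence at \<open>z\<close>.\<close>
  have "summable (\<lambda>k. c k * z ^ k)" for z :: complex
    by (rule powser_inside[OF sums_summable[OF series[of "norm z + 1"]]]) (simp del: of_real_add)
  then have "((\<lambda>z. \<Sum>k. c k * z ^ k) has_field_derivative (\<Sum>k. diffs c k * 0 ^ k)) (at 0)"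
    by (rule termdiffs_strong_converges_everywhere)
  \<comment> \<open>Only the term \<open>k = 0\<close> survives at the origin, and
    \<open>diffs c 0 = c 1 = g Z\<close>.\<close>
  moreover have "(\<Sum>k. diffs c k * 0 ^ k) = g Z"
    by (simp add: diffs_def c_def)
  ultimately have "((\<lambda>t. \<Sum>k. c k * of_real t ^ k) has_vector_derivative g Z) (at 0)"
    using has_vector_derivative_real_field[of "\<lambda>z. \<Sum>k. c k * z ^ k" "g Z" 0 UNIV] by simp
  then show ?thesis
    using series by (simp add: sums_iff)
qed

text \<open>The first form handles the curves through \<open>x\<close>; the second keeps derivatives
  of linear functionals linear, so that differentiation can be iterated.\<close>

lemma linear_mult_shift:
  assumes "linear f"
  shows "linear (\<lambda>M :: real^'n^'n. f (x ** M))" and "linear (\<lambda>M :: real^'n^'n. f (M ** x))"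
  using linear_compose[OF linear_matrix_mult_left assms]
    linear_compose[OF linear_matrix_mult_right assms]
  by (simp_all add: o_def)

lemma lie_deriv_linear:
  assumes "linear f"
  shows "lie_deriv Z f = (\<lambda>x. f (x ** Z))"
  using has_vector_derivative_linear_mat_exp[OF linear_mult_shift(1)[OF assms]]
  by (auto simp: lie_deriv_def vector_derivative_at)

lemma smooth_on_SO_linear:
  fixes f :: "real^'n^'n \<Rightarrow> complex"
  assumes "linear f"
  shows "smooth_on_SO f"
proof -
  have lin: "linear (foldr lie_deriv Zs f)" for Zs
    by (induction Zs) (simp_all add: assms lie_deriv_linear linear_mult_shift(2))
  have "continuous_on SO (foldr lie_deriv Zs f)" for Zs
    using lin by (simp add: linear_continuous_on linear_conv_bounded_linear)
  moreover have "(\<lambda>t. foldr lie_deriv Zs f (x ** mat_exp (t *\<^sub>R Z))) differentiable (at 0)"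
    for Zs x Z
    by (rule differentiableI_vector
      [OF has_vector_derivative_linear_mat_exp[OF linear_mult_shift(1)[OF lin]]])
  ultimately show ?thesis
    by (simp add: smooth_on_SO_def)
qed

lemma so_orthonormal_basis_expand:
  assumes "so_orthonormal_basis B" and "A \<in> so"
  shows "(\<Sum>Z\<in>B. (A \<bullet> Z) *\<^sub>R Z) = A"
proof (rule orthonormal_basis_expand)
  show orth: "pairwise orthogonal B"
    using assms(1)
    by (auto simp: so_orthonormal_basis_def so_metric_eq_inner pairwise_def orthogonal_def)
  show "finite B"
    using orth by (rule pairwise_orthogonal_imp_finite)
  show "norm Z = 1" if "Z \<in> B" for Z
    using assms(1) that by (simp add: so_orthonormal_basis_def so_metric_eq_inner norm_eq_1)
  show "A \<in> span B"
    using assms by (simp add: so_orthonormal_basis_def)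
qed

text \<open>Expand the skew matrix \<open>A\<close> with entry 1 at \<open>(k, l)\<close> and -1 at
  \<open>(l, k)\<close> (zero if \<open>k = l\<close>) in the basis and read off the entry
  \<open>(r, s)\<close>. Skew-symmetry of \<open>Z\<close> makes the coefficients
  \<open>2 * Z $ k $ l\<close>, whence the factor 1/2.\<close>

lemma so_completeness:
  fixes B :: "(real^'n^'n) set"
  assumes "so_orthonormal_basis B"
  shows "(\<Sum>Z\<in>B. Z $ k $ l * Z $ r $ s)
    = (of_bool (k = r \<and> l = s) - of_bool (k = s \<and> l = r)) / 2"
proof -
  define A :: "real^'n^'n" where
    "A = (\<chi> i j. of_bool (k = i \<and> l = j) - of_bool (k = j \<and> l = i))"
  have "A \<in> so"
    by (simp add: A_def so_def transpose_def vec_eq_iff)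
  have inner: "A \<bullet> Z = 2 * Z $ k $ l" if "Z \<in> B" for Z
  proof -
    have "transpose Z = - Z"
      using assms that by (auto simp: so_orthonormal_basis_def so_def)
    from arg_cong[OF this, of "\<lambda>M. M $ k $ l"] have "Z $ l $ k = - Z $ k $ l"
      by (simp add: transpose_def)
    moreover have "A \<bullet> Z = Z $ k $ l - Z $ l $ k"
      by (simp add: inner_vec_def A_def algebra_simps sum_subtractf of_bool_conj sum.delta
          flip: sum_distrib_left sum_distrib_right)
    ultimately show ?thesis by simp
  qed
  have "A $ r $ s = (\<Sum>Z\<in>B. (A \<bullet> Z) *\<^sub>R Z) $ r $ s"
    by (simp add: so_orthonormal_basis_expand[OF assms \<open>A \<in> so\<close>])
  also have "\<dots> = 2 * (\<Sum>Z\<in>B. Z $ k $ l * Z $ r $ s)"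
    by (simp add: inner sum_distrib_left mult_ac)
  finally show ?thesis
    by (simp add: A_def)
qed

text \<open>Contract the two inner indices of \<open>so_completeness\<close>: the first delta term
  sums to \<delta>_ij, the second to n \<delta>_ij.\<close>

lemma so_casimir:
  fixes B :: "(real^'n^'n) set"
  assumes "so_orthonormal_basis B"
  shows "(\<Sum>Z\<in>B. Z ** Z) = (- (real CARD('n) - 1) / 2) *\<^sub>R mat 1"
proof -
  have "(\<Sum>Z\<in>B. Z ** Z) $ i $ j = ((- (real CARD('n) - 1) / 2) *\<^sub>R mat 1) $ i $ j" for i j
  proof -
    have "(\<Sum>Z\<in>B. Z ** Z) $ i $ j = (\<Sum>k\<in>UNIV. \<Sum>Z\<in>B. Z $ i $ k * Z $ k $ j)"
      by (simp add: matrix_matrix_mult_def) (rule sum.swap)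
    also have "\<dots> = (\<Sum>k\<in>UNIV. (of_bool (i = k) * of_bool (k = j) - of_bool (i = j)) / 2)"
      by (simp add: so_completeness[OF assms] of_bool_conj)
    also have "\<dots> = (of_bool (i = j) - real CARD('n) * of_bool (i = j)) / 2"
      by (simp add: sum_subtractf flip: sum_divide_distrib)
    finally show ?thesis
      by (cases "i = j") (simp_all add: mat_def field_simps)
  qed
  then show ?thesis by (simp add: vec_eq_iff)
qed

lemma phi_eq_sum: "phi p a x = (\<Sum>i\<in>UNIV. \<Sum>j\<in>UNIV. p $ i * a $ j * of_real (x $ i $ j))"
  by (simp add: phi_def trace_def matrix_matrix_mult_def transpose_def rowvector_def map_matrix_def)

lemma linear_phi: "linear (phi p a)"
  by (rule linearI)
    (simp_all add: phi_eq_sum algebra_simps sum.distrib scaleR_conv_of_real[where 'a = complex]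
      sum_distrib_left)

text \<open>Absorbing \<open>x\<close> into the row vector \<open>p\<close> isolates the entries of
  \<open>Z\<close>, ready for the completeness relation.\<close>

lemma phi_matrix_mult:
  "phi p a (x ** Z) =
    (\<Sum>k\<in>UNIV. \<Sum>l\<in>UNIV. (p v* map_matrix of_real x) $ k * a $ l * of_real (Z $ k $ l))"
proof -
  have "phi p a (x ** Z)
      = (\<Sum>i\<in>UNIV. \<Sum>l\<in>UNIV. \<Sum>k\<in>UNIV. p $ i * a $ l * of_real (x $ i $ k) * of_real (Z $ k $ l))"
    by (simp add: phi_eq_sum matrix_matrix_mult_def sum_distrib_left mult_ac)
  also have "\<dots>
      = (\<Sum>k\<in>UNIV. \<Sum>l\<in>UNIV. \<Sum>i\<in>UNIV. p $ i * a $ l * of_real (x $ i $ k) * of_real (Z $ k $ l))"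
    by (subst sum.swap, subst sum.swap[of _ UNIV UNIV], intro sum.cong refl sum.swap)
  finally show ?thesis
    by (simp add: vector_matrix_mult_def map_matrix_def sum_distrib_left sum_distrib_right mult_ac)
qed

lemma phi_eq_bilin: "phi p a x = bilin (p v* map_matrix of_real x) a"
proof -
  have "phi p a x = phi p a (x ** mat 1)" by simp
  also have "\<dots> = bilin (p v* map_matrix of_real x) a"
    unfolding phi_matrix_mult
    by (simp add: bilin_def mat_def if_distrib[of of_real] if_distrib cong: if_cong)
  finally show ?thesis .
qed

text \<open>In matrix form, (p x)(q x)^t = p (x x^t) q^t = p q^t, with no complex
  conjugation.\<close>

lemma bilin_vector_matrix_mult_orthogonal:
  assumes "x ** transpose x = mat 1"
  shows "bilin (p v* map_matrix of_real x) (q v* map_matrix of_real x) = bilin p q"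
proof -
  have orth: "complex_of_real (\<Sum>k\<in>UNIV. x $ i $ k * x $ j $ k) = of_bool (i = j)" for i j
    using arg_cong[OF assms, of "\<lambda>M. M $ i $ j"]
    by (cases "i = j") (simp_all add: matrix_matrix_mult_def transpose_def mat_def)
  have "bilin (p v* map_matrix of_real x) (q v* map_matrix of_real x)
      = (\<Sum>k\<in>UNIV. \<Sum>i\<in>UNIV. \<Sum>j\<in>UNIV. p $ i * q $ j * of_real (x $ i $ k * x $ j $ k))"
    by (simp add: bilin_def vector_matrix_mult_def map_matrix_def sum_product mult_ac)
  also have "\<dots> = (\<Sum>i\<in>UNIV. \<Sum>j\<in>UNIV. \<Sum>k\<in>UNIV. p $ i * q $ j * of_real (x $ i $ k * x $ j $ k))"
    by (subst sum.swap, intro sum.cong refl sum.swap)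
  also have "\<dots> = (\<Sum>i\<in>UNIV. \<Sum>j\<in>UNIV. p $ i * q $ j * of_real (\<Sum>k\<in>UNIV. x $ i $ k * x $ j $ k))"
    by (simp add: sum_distrib_left)
  also have "\<dots> = bilin p q"
    by (simp only: orth) (simp add: bilin_def)
  finally show ?thesis .
qed

lemma tau_phi:
  fixes p :: "complex^'n"
  assumes "so_orthonormal_basis B"
  shows "tau B (phi p a) x = - (of_nat CARD('n) - 1) / 2 * phi p a x"
proof -
  have "tau B (phi p a) x = (\<Sum>Z\<in>B. phi p a (x ** (Z ** Z)))"
    by (simp add: tau_def lie_deriv_linear linear_phi linear_mult_shift(2) matrix_mul_assoc)
  also have "\<dots> = phi p a (x ** (\<Sum>Z\<in>B. Z ** Z))"
    by (rule linear_sum[OF linear_mult_shift(1)[OF linear_phi], symmetric])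
  also have "\<dots> = (- (real CARD('n) - 1) / 2) *\<^sub>R phi p a (x ** mat 1)"
    unfolding so_casimir[OF assms] by (rule linear_cmul[OF linear_mult_shift(1)[OF linear_phi]])
  finally show ?thesis
    by (simp add: scaleR_conv_of_real)
qed

lemma kappa_phi:
  fixes p :: "complex^'n"
  assumes B: "so_orthonormal_basis B" and x: "x ** transpose x = mat 1"
  shows "kappa B (phi p a) (phi p b) x = (bilin p p * bilin a b - phi p a x * phi p b x) / 2"
proof -
  define q where "q = p v* map_matrix of_real x"
  have comp: "(\<Sum>Z\<in>B. complex_of_real (Z $ k $ l) * of_real (Z $ r $ s))
      = (of_bool (k = r) * of_bool (l = s) - of_bool (k = s) * of_bool (l = r)) / 2" for k l r s
    using arg_cong[OF so_completeness[OF B, of k l r s], of complex_of_real]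
    by (simp add: of_bool_conj)
  have "kappa B (phi p a) (phi p b) x = (\<Sum>Z\<in>B. \<Sum>k\<in>UNIV. \<Sum>r\<in>UNIV. \<Sum>l\<in>UNIV. \<Sum>s\<in>UNIV.
      q $ k * a $ l * (q $ r * b $ s) * (of_real (Z $ k $ l) * of_real (Z $ r $ s)))"
    by (simp add: kappa_def lie_deriv_linear linear_phi phi_matrix_mult sum_product mult_ac flip: q_def)
  also have "\<dots> = (\<Sum>k\<in>UNIV. \<Sum>r\<in>UNIV. \<Sum>l\<in>UNIV. \<Sum>s\<in>UNIV. \<Sum>Z\<in>B.
      q $ k * a $ l * (q $ r * b $ s) * (of_real (Z $ k $ l) * of_real (Z $ r $ s)))"
    by (subst sum.swap, intro sum.cong refl)+
  also have "\<dots> = (\<Sum>k\<in>UNIV. \<Sum>r\<in>UNIV. \<Sum>l\<in>UNIV. \<Sum>s\<in>UNIV. q $ k * a $ l * (q $ r * b $ s) *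
      ((of_bool (k = r) * of_bool (l = s) - of_bool (k = s) * of_bool (l = r)) / 2))"
    by (simp add: comp flip: sum_distrib_left)
  \<comment> \<open>The deltas are nested so that the sums collapse from the inside out: over
    \<open>s\<close> and \<open>r\<close> in the first term, over \<open>s\<close> and
    \<open>l\<close> in the second.\<close>
  also have "\<dots> = (\<Sum>k\<in>UNIV. \<Sum>r\<in>UNIV. \<Sum>l\<in>UNIV. \<Sum>s\<in>UNIV.
      (of_bool (k = r) * (of_bool (l = s) * (q $ k * q $ r * a $ l * b $ s))
        - of_bool (l = r) * (of_bool (k = s) * (q $ k * q $ r * a $ l * b $ s))) / 2)"
    by (intro sum.cong refl) (simp add: algebra_simps)
  also have "\<dots> = ((\<Sum>k\<in>UNIV. \<Sum>l\<in>UNIV. q $ k * q $ k * a $ l * b $ l)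
      - (\<Sum>k\<in>UNIV. \<Sum>r\<in>UNIV. q $ k * q $ r * a $ r * b $ k)) / 2"
    by (simp add: sum_subtractf flip: sum_divide_distrib sum_distrib_left)
  also have "\<dots> = (bilin q q * bilin a b - bilin q b * bilin q a) / 2"
    unfolding bilin_def sum_product by (simp only: mult_ac)
  finally show ?thesis
    by (simp add: q_def phi_eq_bilin bilin_vector_matrix_mult_orthogonal[OF x] mult.commute)
qed

theorem theorem4p3:
  fixes p :: "complex^'n"
  assumes "p \<noteq> 0" and "bilin p p = 0"
  shows "eigenfamily_on_SO (family_E p)"
proof -
  have "smooth_on_SO f" if "f \<in> family_E p" for f
    using that by (auto simp: family_E_def smooth_on_SO_linear linear_phi)
  \<comment> \<open>Both eigenvalues depend only on the dimension, so one choice serves every basis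
    \<open>B\<close>.\<close>
  moreover have "tau B f x = - (of_nat CARD('n) - 1) / 2 * f x \<and> kappa B f h x = - 1 / 2 * f x * h x"
    if "so_orthonormal_basis B" "f \<in> family_E p" "h \<in> family_E p" "x \<in> SO" for B f h x
    using that assms(2) by (auto simp: family_E_def tau_phi SO_def kappa_phi)
  ultimately show ?thesis
    unfolding eigenfamily_on_SO_def by blast
qed

end
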